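(* Let $m,n$ be positive integers, let $S \subseteq \mathbb{R}$ be an open, closed or clopen interval of the real line, and let $f: S^m \rightarrow\mathbb{R}$. Define $F:\mathcal{M}_{\mathrm{herm}^n}(S)\rightarrow \mathbb{R}$ by $$F(L) = \mathrm{Tr}\left(f(L,L,\ldots,L)\right) = \sum_{j_1,j_2,\ldots,j_m = 1}^n f(\lambda_{j_1}, \lambda_{j_2}, \ldots, \lambda_{j_m}),$$ where $\lambda_1,\lambda_2,\ldots,\lambda_n$ are the eigenvalues of $L$ (with multiplicity). (i) If $f$ is of class $\mathcal{C}^m$ and is monotonically increasing (resp. decreasing) with respect to each of its inputs, then $F$ is monotonically increasing (resp. decreasing) in $\mathcal{M}_{\mathrm{herm}^n}(S)$; that is, for $L_1,L_2\in\mathcal{M}_{\mathrm{herm}^n}(S)$, $L_1 \succcurlyeq L_2 \Rightarrow F(L_1) \geq F(L_2)$ (resp. $F(L_1)\leq F(L_2)$). (ii) If $f$ is of class $\mathcal{C}^0$ and is convex (resp. concave) in $S^m$, then $F$ is convex (resp. concave) in $\mathcal{M}_{\mathrm{herm}^n}(S)$; that is, for $L_1,L_2\in\mathcal{M}_{\mathrm{herm}^n}(S)$ and $\alpha\in[0,1]$, $F(\alpha L_1 + (1-\alpha)L_2) \leq \alpha F(L_1) + (1-\alpha) F(L_2)$ (resp. $\geq$).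
   Context: For $S\subseteq\mathbb{R}$, $\mathcal{M}_{\mathrm{herm}^n}(S)$ is the set of $n\times n$ (complex) Hermitian matrices all of whose eigenvalues lie in $S$. For matrices $A,B$, $A\succcurlyeq B$ means that $A-B$ is positive semi-definite, i.e. $\mathbf{x}^*(A-B)\mathbf{x}\ge 0$ for all $\mathbf{x}\in\mathbb{C}^n$. "Clopen" here is the paper's word for a half-open interval. Extension of $f$ to matrices: for diagonalizable $n\times n$ matrices $M_j = P_j\,\mathrm{diag}(\lambda_{j1},\ldots,\lambda_{jn})P_j^{-1}$ with all eigenvalues in $S$, $j=1,\ldots,m$, the matrix $f(M_1,\ldots,M_m)\in\mathbb{C}^{n^m\times n^m}$ is $$f(M_1,\ldots,M_m)=\Big(\bigotimes_{j=1}^m P_j\Big)\,\mathrm{diag}_{j_1,\ldots,j_m}\big(f(\lambda_{1j_1},\ldots,\lambda_{mj_m})\big)\,\Big(\bigotimes_{j=1}^m P_j^{-1}\Big),$$ where $\otimes$ is the Kronecker product and the diagonal matrix has its $n^m$ entries indexed by $(j_1,\ldots,j_m)\in\{1,\ldots,n\}^m$ in lexicographic order. "Monotonically increasing (decreasing) with respect to each of its inputs" means weakly increasing (decreasing) in each scalar variable separately. *)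

theory Defs
  imports "HOL-Analysis.Analysis"
begin

section \<open>Hermitian matrices and their spectrum\<close>

definition conj_transpose :: "complex^'n^'m \<Rightarrow> complex^'m^'n" where
  "conj_transpose A = (\<chi> i j. cnj (A $ j $ i))"

definition hermitian :: "complex^'n^'n \<Rightarrow> bool" where
  "hermitian A \<longleftrightarrow> conj_transpose A = A"

definition is_eigenvalue :: "complex^'n^'n \<Rightarrow> complex \<Rightarrow> bool" where
  "is_eigenvalue A c \<longleftrightarrow> (\<exists>v. v \<noteq> 0 \<and> A *v v = c *s v)"

definition herm_mats :: "real set \<Rightarrow> (complex^'n^'n) set" where
  "herm_mats S = {A. hermitian A \<and> (\<forall>c. is_eigenvalue A c \<longrightarrow> c \<in> complex_of_real ` S)}"

text \<open>
  A real enumeration of the eigenvalues, each repeated according to its multiplicity as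
  a root of the characteristic polynomial; the order is arbitrary.
\<close>

definition lists_eigenvalues :: "complex^'n^'n \<Rightarrow> ('n \<Rightarrow> real) \<Rightarrow> bool" where
  "lists_eigenvalues A ev \<longleftrightarrow>
     (\<forall>z. det (mat z - A) = (\<Prod>i\<in>UNIV. (z - complex_of_real (ev i))))"

text \<open>Nonnegativity of a complex number includes that it is real.\<close>

definition pos_semidef :: "complex^'n^'n \<Rightarrow> bool" where
  "pos_semidef A \<longleftrightarrow>
     (\<forall>x. (\<Sum>i\<in>UNIV. cnj (x $ i) * (A *v x) $ i) \<in> \<real> \<and>
          0 \<le> Re (\<Sum>i\<in>UNIV. cnj (x $ i) * (A *v x) $ i))"

definition loewner_ge :: "complex^'n^'n \<Rightarrow> complex^'n^'n \<Rightarrow> bool" (infix \<open>\<succcurlyeq>\<close> 50) where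
  "A \<succcurlyeq> B \<longleftrightarrow> pos_semidef (A - B)"


section \<open>Extension of a function of several real variables to matrices\<close>

definition diag_matrix :: "('k \<Rightarrow> complex) \<Rightarrow> complex^'k^'k" where
  "diag_matrix d = (\<chi> i j. if i = j then d i else 0)"

text \<open>
  The Kronecker product of an \<open>'m\<close>-indexed family of square matrices of size \<open>CARD('n)\<close>.
  Rows and columns are indexed by the multi-indices themselves, i.e. by \<open>'n^'m\<close>
  (which has \<open>CARD('n) ^ CARD('m)\<close> elements); listing these lexicographically gives
  the usual matrix.
\<close>

definition kron :: "('m \<Rightarrow> complex^'n^'n) \<Rightarrow> complex^('n^'m)^('n^'m)" where
  "kron A = (\<chi> I J. \<Prod>k\<in>UNIV. A k $ (I $ k) $ (J $ k))"

definition diagonalizes :: "complex^'n^'n \<Rightarrow> complex^'n^'n \<Rightarrow> ('n \<Rightarrow> real) \<Rightarrow> bool" where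
  "diagonalizes M P ev \<longleftrightarrow>
     invertible P \<and> M = P ** diag_matrix (\<lambda>i. complex_of_real (ev i)) ** matrix_inv P"

definition kron_spectral_form ::
    "(real^'m \<Rightarrow> real) \<Rightarrow> ('m \<Rightarrow> complex^'n^'n) \<Rightarrow> ('m \<Rightarrow> 'n \<Rightarrow> real) \<Rightarrow> complex^('n^'m)^('n^'m)" where
  "kron_spectral_form f P \<Lambda> =
     kron P ** diag_matrix (\<lambda>J. complex_of_real (f (\<chi> k. \<Lambda> k (J $ k)))) ** kron (\<lambda>k. matrix_inv (P k))"

text \<open>
  The matrix \<open>f(M\<^sub>1,\<dots>,M\<^sub>m)\<close>, for diagonalizable \<open>M\<^sub>k\<close> with real eigenvalues. It does not
  depend on the diagonalizations chosen; this is lemma \<open>matrix_fun_eq\<close> below.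
\<close>

definition matrix_fun ::
    "(real^'m \<Rightarrow> real) \<Rightarrow> ('m \<Rightarrow> complex^'n^'n) \<Rightarrow> complex^('n^'m)^('n^'m)" where
  "matrix_fun f M =
     (THE X. \<exists>P \<Lambda>. (\<forall>k. diagonalizes (M k) (P k) (\<Lambda> k)) \<and> X = kron_spectral_form f P \<Lambda>)"

lemma kron_mult: "kron A ** kron B = kron (\<lambda>k. A k ** B k)"
  for A B :: "'m::finite \<Rightarrow> complex^'n^'n"
proof -
  have "(\<Sum>K\<in>UNIV. (\<Prod>k\<in>UNIV. A k $ (I $ k) $ (K $ k)) * (\<Prod>k\<in>UNIV. B k $ (K $ k) $ (J $ k)))
      = (\<Prod>k\<in>UNIV. \<Sum>l\<in>UNIV. A k $ (I $ k) $ l * B k $ l $ (J $ k))" for I J :: "'n^'m"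
  proof -
    have "(\<Prod>k\<in>UNIV. \<Sum>l\<in>UNIV. A k $ (I $ k) $ l * B k $ l $ (J $ k))
        = (\<Sum>g\<in>UNIV. \<Prod>k\<in>UNIV. A k $ (I $ k) $ (g k) * B k $ (g k) $ (J $ k))"
      using prod_sum_PiE[of "UNIV :: 'm set" "\<lambda>_. UNIV :: 'n set"
          "\<lambda>k l. A k $ (I $ k) $ l * B k $ l $ (J $ k)"] by simp
    also have "\<dots> = (\<Sum>K\<in>UNIV. \<Prod>k\<in>UNIV. A k $ (I $ k) $ (K $ k) * B k $ (K $ k) $ (J $ k))"
      by (rule sum.reindex_bij_witness[where i = vec_nth and j = vec_lambda])
        (auto simp: vec_lambda_inverse)
    finally show ?thesis by (simp add: prod.distrib)
  qed
  then show ?thesis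
    by (simp add: kron_def matrix_matrix_mult_def vec_eq_iff)
qed

lemma kron_mat_1: "kron (\<lambda>_::'m::finite. mat 1 :: complex^'n^'n) = mat 1"
proof -
  have "(\<Prod>k\<in>UNIV. if I $ k = J $ k then 1 else 0) = (if I = J then 1 else (0::complex))"
    for I J :: "'n^'m"
    by (auto simp: vec_eq_iff)
  then show ?thesis by (simp add: kron_def mat_def vec_eq_iff)
qed

lemma diag_matrix_mult_left: "(diag_matrix d ** A) $ i $ j = d i * A $ i $ j"
  for A :: "complex^'k^'k"
  by (simp add: diag_matrix_def matrix_matrix_mult_def if_distrib[where f = "\<lambda>x. x * _"] cong: if_cong)

lemma diag_matrix_mult_right: "(A ** diag_matrix d) $ i $ j = A $ i $ j * d j"
  for A :: "complex^'k^'k"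
  by (simp add: diag_matrix_def matrix_matrix_mult_def if_distrib[where f = "\<lambda>x. _ * x"] cong: if_cong)

lemma matrix_inv_both:
  assumes "invertible P"
  shows "matrix_inv P ** P = mat 1" "P ** matrix_inv P = mat 1"
  using someI_ex[OF assms[unfolded invertible_def]] by (auto simp: matrix_inv_def)

lemma kron_spectral_form_unique:
  fixes P Q :: "'m::finite \<Rightarrow> complex^'n^'n"
  assumes P: "\<And>k. diagonalizes (M k) (P k) (\<Lambda> k)" and Q: "\<And>k. diagonalizes (M k) (Q k) (\<Lambda>' k)"
  shows "kron_spectral_form f P \<Lambda> = kron_spectral_form f Q \<Lambda>'"
proof -
  define R where "R k = matrix_inv (Q k) ** P k" for k
  define D where "D \<Lambda> = (diag_matrix (\<lambda>J. complex_of_real (f (\<chi> k. \<Lambda> k (J $ k)))) :: complex^('n^'m)^('n^'m))"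
    for \<Lambda> :: "'m \<Rightarrow> 'n \<Rightarrow> real"
  have inv: "matrix_inv (P k) ** P k = mat 1" "P k ** matrix_inv (P k) = mat 1"
     "matrix_inv (Q k) ** Q k = mat 1" "Q k ** matrix_inv (Q k) = mat 1" for k
    using P Q matrix_inv_both unfolding diagonalizes_def by blast+
  have R: "R k ** diag_matrix (\<lambda>i. complex_of_real (\<Lambda> k i))
      = diag_matrix (\<lambda>i. complex_of_real (\<Lambda>' k i)) ** R k" for k
  proof -
    let ?L = "diag_matrix (\<lambda>i. complex_of_real (\<Lambda> k i))"
    let ?L' = "diag_matrix (\<lambda>i. complex_of_real (\<Lambda>' k i))"
    have "P k ** ?L ** matrix_inv (P k) = Q k ** ?L' ** matrix_inv (Q k)"
      using P[of k] Q[of k] by (simp add: diagonalizes_def)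
    then have "matrix_inv (Q k) ** (P k ** ?L ** matrix_inv (P k)) ** P k
        = matrix_inv (Q k) ** (Q k ** ?L' ** matrix_inv (Q k)) ** P k"
      by simp
    also have "matrix_inv (Q k) ** (P k ** ?L ** matrix_inv (P k)) ** P k
        = matrix_inv (Q k) ** P k ** ?L ** (matrix_inv (P k) ** P k)"
      by (simp only: matrix_mul_assoc)
    also have "matrix_inv (Q k) ** (Q k ** ?L' ** matrix_inv (Q k)) ** P k
        = (matrix_inv (Q k) ** Q k) ** ?L' ** (matrix_inv (Q k) ** P k)"
      by (simp only: matrix_mul_assoc)
    finally show ?thesis by (simp add: R_def inv)
  qed
  have R0: "R k $ i $ j = 0 \<or> \<Lambda> k j = \<Lambda>' k i" for k i j
  proof -
    have "R k $ i $ j * complex_of_real (\<Lambda> k j) = complex_of_real (\<Lambda>' k i) * R k $ i $ j"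
      using arg_cong[OF R[of k], of "\<lambda>A. A $ i $ j"]
      by (simp only: diag_matrix_mult_left diag_matrix_mult_right)
    then show ?thesis by auto
  qed
  have KR: "kron R ** D \<Lambda> = D \<Lambda>' ** kron R"
  proof -
    have "kron R $ I $ J * complex_of_real (f (\<chi> k. \<Lambda> k (J $ k)))
        = complex_of_real (f (\<chi> k. \<Lambda>' k (I $ k))) * kron R $ I $ J" for I J :: "'n^'m"
    proof (cases "\<exists>k. R k $ (I $ k) $ (J $ k) = 0")
      case True
      then have "kron R $ I $ J = 0" by (auto simp: kron_def)
      then show ?thesis by simp
    next
      case False
      then have "\<Lambda> k (J $ k) = \<Lambda>' k (I $ k)" for k using R0 by blast
      then show ?thesis by simp
    qed
    then show ?thesis
      unfolding D_def by (simp add: vec_eq_iff diag_matrix_mult_left diag_matrix_mult_right)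
  qed
  have KP: "kron P = kron Q ** kron R"
    by (simp add: kron_mult R_def matrix_mul_assoc inv)
  have KQ: "kron R ** kron (\<lambda>k. matrix_inv (P k)) = kron (\<lambda>k. matrix_inv (Q k))"
    by (simp add: kron_mult R_def inv flip: matrix_mul_assoc)
  have "kron_spectral_form f P \<Lambda> = kron Q ** (kron R ** D \<Lambda>) ** kron (\<lambda>k. matrix_inv (P k))"
    by (simp add: kron_spectral_form_def D_def KP matrix_mul_assoc)
  also have "\<dots> = kron Q ** D \<Lambda>' ** (kron R ** kron (\<lambda>k. matrix_inv (P k)))"
    by (simp add: KR matrix_mul_assoc)
  finally show ?thesis
    by (simp add: KQ kron_spectral_form_def D_def)
qed

lemma matrix_fun_eq:
  fixes P :: "'m::finite \<Rightarrow> complex^'n^'n"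
  assumes "\<And>k. diagonalizes (M k) (P k) (\<Lambda> k)"
  shows "matrix_fun f M = kron_spectral_form f P \<Lambda>"
  unfolding matrix_fun_def
  by (rule the_equality) (use assms in \<open>auto intro: kron_spectral_form_unique\<close>)

text \<open>
  The real part only serves to obtain a real-valued function: on Hermitian matrices
  the trace is real.
\<close>

definition trace_fun :: "(real^'m \<Rightarrow> real) \<Rightarrow> complex^'n^'n \<Rightarrow> real" where
  "trace_fun f L = Re (trace (matrix_fun f (\<lambda>_. L)))"


section \<open>Hypotheses on the function\<close>

definition cube :: "real set \<Rightarrow> (real^'m) set" where
  "cube S = {x. \<forall>k. x $ k \<in> S}"

text \<open>
  Class \<open>C\<^sup>k\<close> on a set that need not be open: derivatives are taken within the set, so they
  are one-sided at those end points of \<open>S\<close> that belong to \<open>S\<close>. On \<open>cube S\<close>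
  with \<open>S\<close> a nondegenerate interval they are unique. The directional derivatives along
  the coordinate vectors are the partial derivatives.
\<close>

primrec Ck_on :: "nat \<Rightarrow> (real^'m \<Rightarrow> real) \<Rightarrow> (real^'m) set \<Rightarrow> bool" where
  "Ck_on 0 f X \<longleftrightarrow> continuous_on X f"
| "Ck_on (Suc k) f X \<longleftrightarrow>
     (\<exists>f'. (\<forall>x\<in>X. (f has_derivative f' x) (at x within X)) \<and> (\<forall>v. Ck_on k (\<lambda>x. f' x v) X))"

definition incr_in_each :: "real set \<Rightarrow> (real^'m \<Rightarrow> real) \<Rightarrow> bool" where
  "incr_in_each S f \<longleftrightarrow>
     (\<forall>x\<in>cube S. \<forall>k. mono_on S (\<lambda>t. f (\<chi> l. if l = k then t else x $ l)))"

definition decr_in_each :: "real set \<Rightarrow> (real^'m \<Rightarrow> real) \<Rightarrow> bool" where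
  "decr_in_each S f \<longleftrightarrow>
     (\<forall>x\<in>cube S. \<forall>k. antimono_on S (\<lambda>t. f (\<chi> l. if l = k then t else x $ l)))"

end

theory Submission
  imports Defs
begin

text \<open>
  By the spectral theorem every Hermitian matrix is \<open>U D U\<^sup>*\<close> with \<open>U\<close> unitary and
  \<open>D\<close> real diagonal. The trace is invariant under similarity and the Kronecker product is
  multiplicative, so the trace of \<open>f(L,\<dots>,L)\<close> is the sum of \<open>f\<close> over all \<open>m\<close>-tuples of
  diagonal entries of \<open>D\<close> (\<open>trace_matrix_fun_spectral_form\<close>). These entries are the roots of
  the characteristic polynomial, hence unique up to a permutation, which does not change the sum.
  Everything else is a comparison of such sums.

  For monotonicity, suppose that \<open>L\<^sub>1 \<succcurlyeq> L\<^sub>2\<close>. For every threshold \<open>t\<close> the matrix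
  \<open>L\<^sub>1\<close> has at least as many eigenvalues \<open>\<ge> t\<close> as \<open>L\<^sub>2\<close>
  (\<open>loewner_ge_imp_count_le\<close>; this is Weyl's monotonicity principle, proved by a dimension
  count). Such a domination of counts gives a bijection between the two spectra along which
  each eigenvalue of \<open>L\<^sub>2\<close> is at most its partner (\<open>dominating_bij\<close>). Applied to all entries
  of a tuple at once, this bijection matches the two sums term by term, and \<open>f\<close> is monotone in
  each argument.

  For convexity, let \<open>u\<^sub>1,\<dots>,u\<^sub>n\<close> be an orthonormal eigenbasis of the combination
  \<open>a A + b B\<close>. Its eigenvalues are \<open>a x\<^sub>j + b y\<^sub>j\<close>, where \<open>x\<^sub>j\<close> and \<open>y\<^sub>j\<close> are the values of the
  quadratic forms of \<open>A\<close> and \<open>B\<close> at \<open>u\<^sub>j\<close>. Convexity of \<open>f\<close> splits the sum, and it remains to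
  compare the sum over tuples of the \<open>x\<^sub>j\<close> with the sum over tuples of eigenvalues of \<open>A\<close>
  (\<open>peierls_inequality\<close>). The squared overlaps of the two eigenbases form a doubly stochastic
  matrix that maps the eigenvalues of \<open>A\<close> to the \<open>x\<^sub>j\<close>; its \<open>m\<close>-fold Kronecker power is again
  doubly stochastic, so Jensen's inequality applies to the tuples.

  The decreasing and concave cases follow by passing to \<open>- f\<close>.
\<close>

section \<open>The Hermitian inner product\<close>

definition hprod :: "complex^'n \<Rightarrow> complex^'n \<Rightarrow> complex" where
  "hprod x y = (\<Sum>i\<in>UNIV. cnj (x $ i) * y $ i)"

lemma hprod_add_right: "hprod x (y + z) = hprod x y + hprod x z"
  by (simp add: hprod_def algebra_simps sum.distrib)

lemma hprod_scaleR_right: "hprod x (c *\<^sub>R y) = of_real c * hprod x y"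
  by (simp add: hprod_def scaleR_conv_of_real[where 'a = complex] sum_distrib_left mult_ac)

lemma hprod_commute: "hprod y x = cnj (hprod x y)"
  by (simp add: hprod_def mult.commute)

lemma hprod_scaleR_left: "hprod (c *\<^sub>R x) y = of_real c * hprod x y"
  by (subst (1 2) hprod_commute) (simp add: hprod_scaleR_right)

lemma inner_eq_Re_hprod: "x \<bullet> y = Re (hprod x y)"
  by (simp add: inner_vec_def inner_complex_def hprod_def)

lemma hprod_same: "hprod x x = of_real (x \<bullet> x)"
proof -
  have "cnj (hprod x x) = hprod x x" by (simp flip: hprod_commute)
  then show ?thesis by (simp add: inner_eq_Re_hprod complex_eq_iff)
qed

lemma inner_self_eq_sum_cmod: "x \<bullet> x = (\<Sum>i\<in>UNIV. (cmod (x $ i))\<^sup>2)"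
  by (simp add: inner_vec_def power2_norm_eq_inner)

lemma hprod_mult_left: "hprod (A *v x) y = hprod x (conj_transpose A *v y)"
proof -
  have "hprod (A *v x) y = (\<Sum>i\<in>UNIV. \<Sum>j\<in>UNIV. cnj (A $ i $ j) * cnj (x $ j) * y $ i)"
    by (simp add: hprod_def matrix_vector_mult_def sum_distrib_right)
  also have "\<dots> = (\<Sum>j\<in>UNIV. \<Sum>i\<in>UNIV. cnj (A $ i $ j) * cnj (x $ j) * y $ i)"
    by (rule sum.swap)
  also have "\<dots> = hprod x (conj_transpose A *v y)"
    by (simp add: hprod_def matrix_vector_mult_def conj_transpose_def sum_distrib_left mult_ac)
  finally show ?thesis .
qed

lemma hermitian_hprod: "hermitian A \<Longrightarrow> hprod (A *v x) y = hprod x (A *v y)"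
  by (simp add: hprod_mult_left hermitian_def)

lemma isCont_hprod_right: "isCont (hprod x) y"
  unfolding hprod_def by (intro continuous_intros)

lemma matrix_vector_mult_scaleR_complex: "A *v (c *\<^sub>R x) = c *\<^sub>R (A *v x)" for A :: "complex^'n^'m"
  by (simp add: matrix_vector_mult_def vec_eq_iff scaleR_right.sum)

text \<open>
  Fewer than \<open>n\<close> vectors do not span \<open>\<complex>\<^sup>n\<close>: written as the rows of a square matrix they leave
  a zero row, so the matrix is singular and has a nonzero kernel vector.
\<close>

lemma exists_orthogonal_vector:
  fixes B :: "(complex^'n) set"
  assumes "finite B" "card B < CARD('n)"
  obtains x where "x \<noteq> 0" "\<And>b. b \<in> B \<Longrightarrow> hprod b x = 0"
proof -
  obtain g :: "complex^'n \<Rightarrow> 'n" where g: "inj_on g B"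
    using assms by (metis card_le_inj finite less_imp_le)
  have "card (g ` B) < CARD('n)" using assms g by (simp add: card_image)
  then obtain i where i: "i \<notin> g ` B" by (metis UNIV_eq_I less_irrefl)
  define M :: "complex^'n^'n" where
    "M = (\<chi> i j. if i \<in> g ` B then cnj (the_inv_into B g i $ j) else 0)"
  have "row i M = 0" using i by (simp add: row_def M_def vec_eq_iff)
  then have "det M = 0" by (rule det_zero_row)
  then have "\<not> (\<exists>N. N ** M = mat 1)"
    by (metis det_I det_mul mult_zero_right zero_neq_one)
  then obtain x where x: "M *v x = 0" "x \<noteq> 0"
    unfolding matrix_left_invertible_ker by blast
  show thesis
  proof
    fix b assume b: "b \<in> B"
    have "hprod b x = (M *v x) $ g b"
      using b g by (simp add: hprod_def matrix_vector_mult_def M_def the_inv_into_f_f)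
    then show "hprod b x = 0" using x by simp
  qed (fact x)
qed

section \<open>The spectral theorem\<close>

text \<open>
  The first-order condition at a maximum, in the form in which the eigenvector argument uses it.
\<close>

lemma nonpos_quadratic_imp_linear_zero:
  fixes a b :: real
  assumes "\<And>t. 2 * t * a + t\<^sup>2 * b \<le> 0" "a \<ge> 0"
  shows "a = 0"
proof (rule ccontr)
  assume "a \<noteq> 0"
  then have a: "a > 0" using assms by simp
  \<comment> \<open>At \<open>t = a s\<close> with this small \<open>s\<close> the linear term beats the quadratic one.\<close>
  define s where "s = 1 / (\<bar>b\<bar> + 1)"
  have s: "s > 0" "s * \<bar>b\<bar> < 1" by (auto simp: s_def field_simps)
  have "2 * (a * s) * a + (a * s)\<^sup>2 * b = a\<^sup>2 * s * (2 + s * b)"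
    by (simp add: power2_eq_square algebra_simps)
  moreover have "2 + s * b > 0"
  proof -
    have "\<bar>s * b\<bar> < 1" using s by (simp add: abs_mult)
    then show ?thesis by linarith
  qed
  then have "a\<^sup>2 * s * (2 + s * b) > 0" using a s by simp
  ultimately show False using assms(1)[of "a * s"] by linarith
qed

text \<open>
  The inductive step of the spectral theorem. The orthogonal complement \<open>W\<close> of \<open>B\<close> is
  invariant under \<open>A\<close>. Regarding \<open>\<complex>\<^sup>n\<close> as a real Euclidean space, the form \<open>x \<bullet> A x\<close> attains
  a maximum on the unit sphere of \<open>W\<close> at some \<open>v\<close>. The residual \<open>w = A v - (v \<bullet> A v) v\<close> lies
  in \<open>W\<close>; moving from \<open>v\<close> in direction \<open>w\<close> would increase the form to first order at the
  rate \<open>2 (w \<bullet> w)\<close>, so \<open>w = 0\<close>.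
\<close>

lemma hermitian_eigenvector_orthogonal:
  fixes A :: "complex^'n^'n"
  assumes A: "hermitian A" and B: "finite B" "card B < CARD('n)"
    and eig: "\<And>b. b \<in> B \<Longrightarrow> \<exists>c::real. A *v b = c *\<^sub>R b"
  obtains v and c :: real where "hprod v v = 1" "\<And>b. b \<in> B \<Longrightarrow> hprod b v = 0" "A *v v = c *\<^sub>R v"
proof -
  define W where "W = {x. \<forall>b\<in>B. hprod b x = 0}"
  define q where "q x = x \<bullet> (A *v x)" for x
  have W_add: "x + y \<in> W" if "x \<in> W" "y \<in> W" for x y
    using that by (simp add: W_def hprod_add_right)
  have W_scale: "s *\<^sub>R x \<in> W" if "x \<in> W" for x and s :: real
    using that by (simp add: W_def hprod_scaleR_right)
  have W_inv: "A *v x \<in> W" if "x \<in> W" for x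
    unfolding W_def
  proof safe
    fix b assume b: "b \<in> B"
    obtain s :: real where "A *v b = s *\<^sub>R b" using eig b by blast
    then have "hprod b (A *v x) = hprod (s *\<^sub>R b) x"
      by (simp flip: hermitian_hprod[OF A])
    also have "\<dots> = 0" using that b by (simp add: hprod_scaleR_left W_def)
    finally show "hprod b (A *v x) = 0" .
  qed
  have W_eq: "W = (\<Inter>b\<in>B. hprod b -` {0})" by (auto simp: W_def)
  have "closed W"
    unfolding W_eq
    by (intro closed_INT ballI continuous_closed_vimage isCont_hprod_right closed_singleton)
  then have compact: "compact (sphere 0 1 \<inter> W)" by (intro compact_Int_closed) auto
  obtain x0 where "x0 \<noteq> 0" "\<And>b. b \<in> B \<Longrightarrow> hprod b x0 = 0"
    using exists_orthogonal_vector[OF B] by metis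
  then have "x0 \<noteq> 0" "x0 \<in> W" by (simp_all add: W_def)
  then have "(1 / norm x0) *\<^sub>R x0 \<in> sphere 0 1 \<inter> W" by (auto intro: W_scale)
  then have nonempty: "sphere 0 1 \<inter> W \<noteq> {}" by blast
  have "continuous_on (sphere 0 1 \<inter> W) q"
    unfolding q_def by (intro continuous_intros linear_continuous_on matrix_vector_mul_bounded_linear)
  with compact nonempty obtain v where v: "v \<in> sphere 0 1 \<inter> W"
    and max: "\<And>x. x \<in> sphere 0 1 \<inter> W \<Longrightarrow> q x \<le> q v"
    using continuous_attains_sup by metis
  have vv: "v \<bullet> v = 1" and vW: "v \<in> W" using v by (auto simp: norm_eq_1)
  have bound: "q x \<le> q v * (x \<bullet> x)" if "x \<in> W" for x
  proof (cases "x = 0")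
    case True
    then show ?thesis by (simp add: q_def)
  next
    case False
    have "q ((1 / norm x) *\<^sub>R x) \<le> q v"
      using that False by (intro max) (auto intro: W_scale)
    moreover have "q ((1 / norm x) *\<^sub>R x) = q x / (x \<bullet> x)"
      by (simp add: q_def matrix_vector_mult_scaleR_complex power2_norm_eq_inner[symmetric] power2_eq_square)
    ultimately show ?thesis using False by (simp add: field_simps)
  qed
  define w where "w = A *v v - q v *\<^sub>R v"
  have wW: "w \<in> W"
    using W_add[OF W_inv[OF vW] W_scale[OF vW, of "- q v"]] by (simp add: w_def)
  have vw: "v \<bullet> w = 0" by (simp add: w_def inner_diff_right vv flip: q_def)
  have wAv: "w \<bullet> (A *v v) = w \<bullet> w"
  proof -
    have "A *v v = w + q v *\<^sub>R v" by (simp add: w_def)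
    then show ?thesis by (metis inner_add_right inner_commute inner_scaleR_right mult_zero_right add.right_neutral vw)
  qed
  have vAw: "v \<bullet> (A *v w) = w \<bullet> w"
  proof -
    have "v \<bullet> (A *v w) = (A *v v) \<bullet> w"
      by (simp add: inner_eq_Re_hprod hermitian_hprod[OF A])
    then show ?thesis using wAv by (simp add: inner_commute)
  qed
  have "2 * t * (w \<bullet> w) + t\<^sup>2 * (q w - q v * (w \<bullet> w)) \<le> 0" for t
  proof -
    have "q (v + t *\<^sub>R w) = q v + 2 * t * (w \<bullet> w) + t\<^sup>2 * q w"
      by (simp add: q_def matrix_vector_right_distrib matrix_vector_mult_scaleR_complex
          inner_add_left inner_add_right vAw wAv power2_eq_square algebra_simps)
    moreover have "(v + t *\<^sub>R w) \<bullet> (v + t *\<^sub>R w) = 1 + t\<^sup>2 * (w \<bullet> w)"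
      using vw by (simp add: inner_add_left inner_add_right vv inner_commute[of w v] power2_eq_square)
    moreover have "q (v + t *\<^sub>R w) \<le> q v * ((v + t *\<^sub>R w) \<bullet> (v + t *\<^sub>R w))"
      by (intro bound W_add vW W_scale wW)
    ultimately show ?thesis by (simp add: algebra_simps)
  qed
  then have "w \<bullet> w = 0" by (rule nonpos_quadratic_imp_linear_zero) simp
  then have "A *v v = q v *\<^sub>R v" by (simp add: w_def)
  then show thesis using vv vW by (intro that[of v "q v"]) (auto simp: hprod_same W_def)
qed

lemma hermitian_orthonormal_eigenvectors:
  fixes A :: "complex^'n^'n" and I :: "'n set"
  assumes A: "hermitian A"
  shows "\<exists>(u :: 'n \<Rightarrow> complex^'n) (ev :: 'n \<Rightarrow> real).
    \<forall>i\<in>I. A *v u i = ev i *\<^sub>R u i \<and> (\<forall>j\<in>I. hprod (u i) (u j) = (if i = j then 1 else 0))"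
  using finite[of I]
proof (induction I rule: finite_induct)
  case empty
  show ?case by simp
next
  case (insert i I)
  then obtain u :: "'n \<Rightarrow> complex^'n" and ev :: "'n \<Rightarrow> real"
    where u: "\<And>i. i \<in> I \<Longrightarrow> A *v u i = ev i *\<^sub>R u i"
      "\<And>i j. i \<in> I \<Longrightarrow> j \<in> I \<Longrightarrow> hprod (u i) (u j) = (if i = j then 1 else 0)"
    by blast
  have "I \<subset> UNIV" using insert by blast
  then have "card (u ` I) < CARD('n)"
    by (meson card_image_le finite le_less_trans psubset_card_mono)
  moreover have "\<exists>c::real. A *v b = c *\<^sub>R b" if "b \<in> u ` I" for b
    using that u(1) by blast
  ultimately obtain v c where v: "hprod v v = 1" "\<And>b. b \<in> u ` I \<Longrightarrow> hprod b v = 0" "A *v v = c *\<^sub>R v"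
    using hermitian_eigenvector_orthogonal[OF A, of "u ` I"] insert.hyps(1) by (metis finite_imageI)
  have "hprod v b = 0" if "b \<in> u ` I" for b
    using v(2)[OF that] by (subst hprod_commute) simp
  then show ?case
    using insert.hyps u v
    by (intro exI[of _ "u(i := v)"] exI[of _ "ev(i := c)"]) auto
qed

definition unitary :: "complex^'n^'n \<Rightarrow> bool" where
  "unitary U \<longleftrightarrow> conj_transpose U ** U = mat 1"

definition spectral_form :: "complex^'n^'n \<Rightarrow> ('n \<Rightarrow> real) \<Rightarrow> complex^'n^'n" where
  "spectral_form U ev = U ** diag_matrix (\<lambda>i. complex_of_real (ev i)) ** conj_transpose U"

lemma unitary_right: "unitary U \<Longrightarrow> U ** conj_transpose U = mat 1"
  by (simp add: unitary_def matrix_left_right_inverse)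

lemma unitary_matrix_inv: "unitary U \<Longrightarrow> invertible U \<and> matrix_inv U = conj_transpose U"
  by (metis invertible_def matrix_inv_both(1) matrix_mul_assoc matrix_mul_lid matrix_mul_rid unitary_def unitary_right)

lemma conj_transpose_mult: "conj_transpose (A ** B) = conj_transpose B ** conj_transpose A"
  by (simp add: conj_transpose_def matrix_matrix_mult_def vec_eq_iff mult.commute)

lemma conj_transpose_conj_transpose [simp]: "conj_transpose (conj_transpose A) = A"
  by (simp add: conj_transpose_def vec_eq_iff)

lemma hermitian_spectral_form: "hermitian (spectral_form U ev)"
proof -
  have "conj_transpose (diag_matrix (\<lambda>i. complex_of_real (ev i))) = diag_matrix (\<lambda>i. complex_of_real (ev i))"
    by (auto simp: conj_transpose_def diag_matrix_def vec_eq_iff)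
  then show ?thesis
    by (simp add: hermitian_def spectral_form_def conj_transpose_mult matrix_mul_assoc)
qed

theorem hermitian_spectral_theorem:
  fixes A :: "complex^'n^'n"
  assumes "hermitian A"
  obtains U ev where "unitary U" "A = spectral_form U ev"
proof -
  obtain u :: "'n \<Rightarrow> complex^'n" and ev :: "'n \<Rightarrow> real"
    where u: "\<And>i. A *v u i = ev i *\<^sub>R u i"
      "\<And>i j. hprod (u i) (u j) = (if i = j then 1 else 0)"
    using hermitian_orthonormal_eigenvectors[OF assms, of UNIV] by blast
  define U :: "complex^'n^'n" where "U = (\<chi> i j. u j $ i)"
  have U: "unitary U"
    using u(2) by (simp add: unitary_def U_def conj_transpose_def matrix_matrix_mult_def mat_def vec_eq_iff hprod_def)
  have "(A ** U) $ i $ j = (U ** diag_matrix (\<lambda>i. complex_of_real (ev i))) $ i $ j" for i j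
    using arg_cong[OF u(1)[of j], of "\<lambda>x. x $ i"]
    by (simp add: diag_matrix_mult_right)
      (simp add: U_def matrix_matrix_mult_def matrix_vector_mult_def scaleR_conv_of_real mult.commute)
  then have "A ** U = U ** diag_matrix (\<lambda>i. complex_of_real (ev i))" by (simp add: vec_eq_iff)
  then have "spectral_form U ev = A ** (U ** conj_transpose U)"
    by (simp add: spectral_form_def matrix_mul_assoc)
  then have "A = spectral_form U ev" by (simp add: unitary_right[OF U])
  with U show thesis by (rule that)
qed

lemma spectral_form_nth:
  "spectral_form U ev $ i $ j = (\<Sum>k\<in>UNIV. U $ i $ k * of_real (ev k) * cnj (U $ j $ k))"
proof -
  have "spectral_form U ev $ i $ j
      = (\<Sum>k\<in>UNIV. (U ** diag_matrix (\<lambda>i. complex_of_real (ev i))) $ i $ k * cnj (U $ j $ k))"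
    by (simp add: spectral_form_def conj_transpose_def matrix_matrix_mult_def[of "U ** _"])
  then show ?thesis by (simp add: diag_matrix_mult_right)
qed

lemma diagonalizes_spectral_form: "unitary U \<Longrightarrow> diagonalizes (spectral_form U ev) U ev"
  using unitary_matrix_inv[of U] by (simp add: diagonalizes_def spectral_form_def)

section \<open>Eigenvalues with multiplicity\<close>

text \<open>
  The roots of a polynomial determine its linear factors with multiplicity: cancel one common
  factor at a time.
\<close>

lemma linear_product_roots_bij:
  fixes a :: "'a \<Rightarrow> 'c::idom" and b :: "'b \<Rightarrow> 'c"
  assumes "finite A" "finite B" "card A = card B"
    and "(\<Prod>i\<in>A. [:- a i, 1:]) = (\<Prod>j\<in>B. [:- b j, 1:])"
  shows "\<exists>\<sigma>. bij_betw \<sigma> A B \<and> (\<forall>i\<in>A. b (\<sigma> i) = a i)"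
  using assms
proof (induction A arbitrary: B rule: finite_induct)
  case empty
  then show ?case by (auto simp: bij_betw_def)
next
  case (insert i A)
  have "poly (\<Prod>j\<in>B. [:- b j, 1:]) (a i) = 0"
    using insert.hyps by (simp add: poly_prod flip: insert.prems(3))
  then obtain j where j: "j \<in> B" "b j = a i"
    using insert.prems(1) by (auto simp: poly_prod)
  have "[:- a i, 1:] * (\<Prod>i\<in>A. [:- a i, 1:]) = [:- a i, 1:] * (\<Prod>j\<in>B - {j}. [:- b j, 1:])"
    using insert.prems insert.hyps j by (simp add: prod.remove[of B j])
  then have "(\<Prod>i\<in>A. [:- a i, 1:]) = (\<Prod>j\<in>B - {j}. [:- b j, 1:])"
    by (simp only: mult_cancel_left) simp
  moreover have "card A = card (B - {j})" using insert.prems insert.hyps j by simp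
  ultimately obtain \<sigma> where \<sigma>: "bij_betw \<sigma> A (B - {j})" "\<And>i. i \<in> A \<Longrightarrow> b (\<sigma> i) = a i"
    using insert.IH[of "B - {j}"] insert.prems(1) by blast
  have "bij_betw (\<sigma>(i := j)) (insert i A) (insert j (B - {j}))"
    using \<sigma>(1) insert.hyps(2) by (auto simp: bij_betw_def inj_on_def)
  then have "bij_betw (\<sigma>(i := j)) (insert i A) B" using j by (simp add: insert_absorb)
  moreover have "\<forall>x\<in>insert i A. b ((\<sigma>(i := j)) x) = a x" using \<sigma>(2) j by auto
  ultimately show ?case by blast
qed

lemma lists_eigenvalues_spectral_form:
  assumes "unitary U"
  shows "lists_eigenvalues (spectral_form U ev) ev"
  unfolding lists_eigenvalues_def
proof
  fix z
  let ?D = "diag_matrix (\<lambda>i. z - complex_of_real (ev i))"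
  have "(mat z - spectral_form U ev) $ i $ j = (U ** ?D ** conj_transpose U) $ i $ j" for i j
  proof -
    have "(U ** ?D ** conj_transpose U) $ i $ j = (\<Sum>k\<in>UNIV. (U ** ?D) $ i $ k * cnj (U $ j $ k))"
      by (simp add: conj_transpose_def matrix_matrix_mult_def[of "U ** _"])
    also have "\<dots> = (\<Sum>k\<in>UNIV. U $ i $ k * (z - of_real (ev k)) * cnj (U $ j $ k))"
      by (simp add: diag_matrix_mult_right)
    also have "\<dots> = z * (\<Sum>k\<in>UNIV. U $ i $ k * cnj (U $ j $ k)) - spectral_form U ev $ i $ j"
      by (simp add: spectral_form_nth algebra_simps sum_subtractf sum_distrib_left)
    also have "(\<Sum>k\<in>UNIV. U $ i $ k * cnj (U $ j $ k)) = (U ** conj_transpose U) $ i $ j"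
      by (simp add: matrix_matrix_mult_def conj_transpose_def)
    finally show ?thesis by (simp add: unitary_right[OF assms] mat_def)
  qed
  then have "mat z - spectral_form U ev = U ** ?D ** conj_transpose U" by (simp add: vec_eq_iff)
  moreover have "det U * det (conj_transpose U) = 1"
    by (metis det_I det_mul unitary_right[OF assms])
  moreover have "det ?D = (\<Prod>i\<in>UNIV. z - complex_of_real (ev i))"
    by (subst det_diagonal) (auto simp: diag_matrix_def)
  ultimately show "det (mat z - spectral_form U ev) = (\<Prod>i\<in>UNIV. z - complex_of_real (ev i))"
    by (simp add: det_mul)
qed

text \<open>
  Two enumerations of the spectrum give the same characteristic polynomial as a function, hence
  as a polynomial, because \<open>\<complex>\<close> is infinite.
\<close>

lemma lists_eigenvalues_unique:
  fixes A :: "complex^'n^'n"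
  assumes "lists_eigenvalues A ev" "lists_eigenvalues A ev'"
  obtains \<sigma> where "bij \<sigma>" "ev = ev' \<circ> \<sigma>"
proof -
  have "poly (\<Prod>i\<in>UNIV. [:- complex_of_real (ev i), 1:]) = poly (\<Prod>i\<in>UNIV. [:- complex_of_real (ev' i), 1:])"
    using assms by (auto simp: lists_eigenvalues_def poly_prod)
  then have "(\<Prod>i\<in>UNIV. [:- complex_of_real (ev i), 1:]) = (\<Prod>i\<in>UNIV. [:- complex_of_real (ev' i), 1:])"
    by (simp only: poly_eq_poly_eq_iff)
  then have "\<exists>\<sigma>. bij \<sigma> \<and> (\<forall>i\<in>UNIV. complex_of_real (ev' (\<sigma> i)) = of_real (ev i))"
    by (intro linear_product_roots_bij) auto
  then show thesis using that by (force simp: fun_eq_iff)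
qed

lemma spectral_form_eigenvector:
  assumes "unitary U"
  shows "spectral_form U ev *v column i U = ev i *\<^sub>R column i U" "column i U \<noteq> 0"
proof -
  let ?D = "diag_matrix (\<lambda>i. complex_of_real (ev i))"
  have "spectral_form U ev ** U = U ** ?D"
    using assms by (simp add: spectral_form_def unitary_def flip: matrix_mul_assoc)
  then have "(spectral_form U ev ** U) $ k $ i = (U ** ?D) $ k $ i" for k by simp
  then have "(spectral_form U ev *v column i U) $ k = of_real (ev i) * U $ k $ i" for k
    by (simp add: diag_matrix_mult_right)
      (simp add: matrix_matrix_mult_def matrix_vector_mult_def column_def)
  then show "spectral_form U ev *v column i U = ev i *\<^sub>R column i U"
    by (simp add: vec_eq_iff column_def scaleR_conv_of_real[where 'a = complex])
  have "(conj_transpose U ** U) $ i $ i = 1" using assms by (simp add: unitary_def mat_def)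
  then have "(\<Sum>k\<in>UNIV. cnj (U $ k $ i) * column i U $ k) = 1"
    by (simp add: matrix_matrix_mult_def conj_transpose_def column_def)
  then show "column i U \<noteq> 0" by auto
qed

section \<open>Quadratic forms\<close>

definition qform :: "complex^'n^'n \<Rightarrow> complex^'n \<Rightarrow> real" where
  "qform A x = Re (hprod x (A *v x))"

lemma qform_linear: "qform (a *\<^sub>R A + b *\<^sub>R B) x = a * qform A x + b * qform B x"
proof -
  have "(a *\<^sub>R A + b *\<^sub>R B) *v x = a *\<^sub>R (A *v x) + b *\<^sub>R (B *v x)"
    by (simp add: matrix_vector_mult_def vec_eq_iff algebra_simps sum.distrib scaleR_right.sum)
  then show ?thesis by (simp add: qform_def hprod_add_right hprod_scaleR_right)
qed

lemma loewner_ge_imp_qform: "A \<succcurlyeq> B \<Longrightarrow> qform B x \<le> qform A x"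
  unfolding loewner_ge_def pos_semidef_def
  by (drule spec[of _ x]) (simp add: qform_def hprod_def matrix_vector_mult_diff_rdistrib algebra_simps sum_subtractf)

lemma qform_spectral_form:
  "qform (spectral_form U ev) x = (\<Sum>i\<in>UNIV. ev i * (cmod ((conj_transpose U *v x) $ i))\<^sup>2)"
proof -
  let ?D = "diag_matrix (\<lambda>i. complex_of_real (ev i))" and ?y = "conj_transpose U *v x"
  have D: "(?D *v ?y) $ i = of_real (ev i) * ?y $ i" for i
    by (simp add: diag_matrix_def matrix_vector_mult_def if_distrib[where f = "\<lambda>x. x * _"] cong: if_cong)
  have "hprod x (spectral_form U ev *v x) = hprod ?y (?D *v ?y)"
    by (simp add: hprod_mult_left spectral_form_def matrix_vector_mul_assoc matrix_mul_assoc)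
  also have "\<dots> = (\<Sum>i\<in>UNIV. of_real (ev i) * (cnj (?y $ i) * ?y $ i))"
    unfolding hprod_def D by (simp add: mult_ac)
  also have "\<dots> = (\<Sum>i\<in>UNIV. of_real (ev i * (cmod (?y $ i))\<^sup>2))"
    by (simp add: complex_norm_square mult.commute del: of_real_power)
  finally show ?thesis unfolding qform_def by simp
qed

lemma unitary_isometry:
  assumes "unitary U"
  shows "(\<Sum>i\<in>UNIV. (cmod ((conj_transpose U *v x) $ i))\<^sup>2) = x \<bullet> x"
proof -
  have "(conj_transpose U *v x) \<bullet> (conj_transpose U *v x) = x \<bullet> x"
    by (simp add: inner_eq_Re_hprod hprod_mult_left matrix_vector_mul_assoc unitary_right[OF assms])
  then show ?thesis by (simp add: inner_self_eq_sum_cmod)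
qed

lemma unitary_transpose_column: "unitary U \<Longrightarrow> conj_transpose U *v column j U = axis j 1"
proof -
  assume "unitary U"
  then have "(conj_transpose U ** U) $ i $ j = mat 1 $ i $ j" for i by (simp add: unitary_def)
  then show ?thesis
    by (auto simp: vec_eq_iff matrix_vector_mult_def matrix_matrix_mult_def column_def axis_def mat_def)
qed

lemma cmod_axis_power2: "(cmod (axis j 1 $ i))\<^sup>2 = (if i = j then 1 else 0)"
  by (simp add: axis_def)

lemma qform_spectral_form_column:
  assumes "unitary U"
  shows "qform (spectral_form U ev) (column j U) = ev j"
proof -
  have "qform (spectral_form U ev) (column j U) = (\<Sum>i\<in>UNIV. if i = j then ev i else 0)"
    unfolding qform_spectral_form unitary_transpose_column[OF assms] cmod_axis_power2
    by (rule sum.cong) auto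
  then show ?thesis by simp
qed

text \<open>
  With \<open>u\<^sub>j\<close>, \<open>v\<^sub>l\<close> the columns of \<open>U\<close>, \<open>V\<close>, this is the squared modulus of the inner product
  of \<open>v\<^sub>l\<close> and \<open>u\<^sub>j\<close>. For unitary \<open>U\<close>, \<open>V\<close> the matrix of overlaps is doubly stochastic.
\<close>

definition overlap :: "complex^'n^'n \<Rightarrow> complex^'n^'n \<Rightarrow> 'n \<Rightarrow> 'n \<Rightarrow> real" where
  "overlap U V j l = (cmod ((conj_transpose V *v column j U) $ l))\<^sup>2"

lemma overlap_nonneg: "overlap U V j l \<ge> 0" by (simp add: overlap_def)

lemma overlap_commute: "overlap U V j l = overlap V U l j"
proof -
  have "(conj_transpose V *v column j U) $ l = cnj ((conj_transpose U *v column l V) $ j)"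
    by (simp add: matrix_vector_mult_def conj_transpose_def column_def mult.commute)
  then show ?thesis by (simp add: overlap_def)
qed

lemma sum_overlap:
  assumes "unitary U" "unitary V"
  shows "(\<Sum>l\<in>UNIV. overlap U V j l) = 1"
proof -
  have "(\<Sum>l\<in>UNIV. overlap U V j l) = column j U \<bullet> column j U"
    unfolding overlap_def by (rule unitary_isometry[OF assms(2)])
  also have "\<dots> = (\<Sum>i\<in>UNIV. (cmod ((conj_transpose U *v column j U) $ i))\<^sup>2)"
    by (rule unitary_isometry[OF assms(1), symmetric])
  also have "\<dots> = 1"
    unfolding unitary_transpose_column[OF assms(1)] cmod_axis_power2 by simp
  finally show ?thesis .
qed

lemma sum_overlap': "unitary U \<Longrightarrow> unitary V \<Longrightarrow> (\<Sum>j\<in>UNIV. overlap U V j l) = 1"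
  using sum_overlap[of V U l] by (simp add: overlap_commute[of U V])

lemma qform_eq_overlap:
  "qform (spectral_form V \<mu>) (column j U) = (\<Sum>l\<in>UNIV. overlap U V j l * \<mu> l)"
  by (simp add: qform_spectral_form overlap_def mult.commute)

text \<open>
  The values of the quadratic form at an orthonormal basis are convex combinations of the
  eigenvalues, so they stay in the interval on which \<open>f\<close> lives.
\<close>

lemma qform_column_mem:
  assumes "unitary U" "unitary V" "convex S" "range \<mu> \<subseteq> S"
  shows "qform (spectral_form V \<mu>) (column j U) \<in> S"
proof -
  have "(\<Sum>l\<in>UNIV. overlap U V j l *\<^sub>R \<mu> l) \<in> S"
    using assms by (intro convex_sum sum_overlap overlap_nonneg) auto
  then show ?thesis by (simp add: qform_eq_overlap)
qed

section \<open>Hermitian matrices with spectrum in an interval\<close>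

lemma herm_matsE:
  assumes "L \<in> herm_mats S"
  obtains U ev where "unitary U" "range ev \<subseteq> S" "L = spectral_form U ev"
proof -
  have "hermitian L" using assms by (simp add: herm_mats_def)
  then obtain U ev where U: "unitary U" "L = spectral_form U ev" by (rule hermitian_spectral_theorem)
  have "is_eigenvalue L (of_real (ev i))" for i
    unfolding is_eigenvalue_def U(2)
    using spectral_form_eigenvector(1)[OF U(1), of ev i] spectral_form_eigenvector(2)[OF U(1), of i]
    by (intro exI[of _ "column i U"]) (simp add: vec_eq_iff[of "_ *\<^sub>R _"] vec_eq_iff[of _ "_ *s _"] scaleR_conv_of_real[where 'a = complex])
  then have "complex_of_real (ev i) \<in> of_real ` S" for i using assms by (simp add: herm_mats_def)
  then have "range ev \<subseteq> S" by force
  then show thesis using U by (intro that)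
qed

lemma spectral_form_in_herm_mats:
  assumes U: "unitary U" and ev: "range ev \<subseteq> S"
  shows "spectral_form U ev \<in> herm_mats S"
  unfolding herm_mats_def
proof safe
  fix c assume "is_eigenvalue (spectral_form U ev) c"
  then obtain v where v: "v \<noteq> 0" "spectral_form U ev *v v = c *s v"
    by (auto simp: is_eigenvalue_def)
  have "(mat c - spectral_form U ev) *v v = 0"
    by (simp add: v matrix_vector_mult_diff_rdistrib)
      (simp add: vec_eq_iff matrix_vector_mult_def mat_def if_distrib[where f = "\<lambda>x. x * _"] cong: if_cong)
  then have "\<not> (\<exists>B. B ** (mat c - spectral_form U ev) = mat 1)"
    using v(1) unfolding matrix_left_invertible_ker by blast
  then have "det (mat c - spectral_form U ev) = 0"
    using invertible_det_nz[of "mat c - spectral_form U ev"] invertible_left_inverse by blast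
  then have "(\<Prod>i\<in>UNIV. c - complex_of_real (ev i)) = 0"
    using lists_eigenvalues_spectral_form[OF U, of ev] by (simp add: lists_eigenvalues_def)
  then show "c \<in> complex_of_real ` S" using ev by auto
qed (rule hermitian_spectral_form)

lemma hermitian_combination:
  assumes "hermitian A" "hermitian B"
  shows "hermitian (a *\<^sub>R A + b *\<^sub>R B)"
proof -
  have "conj_transpose (a *\<^sub>R A + b *\<^sub>R B) = a *\<^sub>R conj_transpose A + b *\<^sub>R conj_transpose B"
    by (simp add: conj_transpose_def vec_eq_iff)
  then show ?thesis using assms by (simp add: hermitian_def)
qed

text \<open>
  The eigenvalues of a combination are read off as values of the two quadratic forms at its own
  eigenvectors; convexity of the domain and convexity of the trace both start from this.
\<close>

lemma spectral_form_combination: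
  fixes U\<^sub>1 U\<^sub>2 :: "complex^'n^'n" and a b :: real
  obtains U ev where "unitary U"
    "a *\<^sub>R spectral_form U\<^sub>1 \<mu>\<^sub>1 + b *\<^sub>R spectral_form U\<^sub>2 \<mu>\<^sub>2 = spectral_form U ev"
    "\<And>j. ev j = a * qform (spectral_form U\<^sub>1 \<mu>\<^sub>1) (column j U) + b * qform (spectral_form U\<^sub>2 \<mu>\<^sub>2) (column j U)"
proof -
  obtain U ev where U: "unitary U"
    "a *\<^sub>R spectral_form U\<^sub>1 \<mu>\<^sub>1 + b *\<^sub>R spectral_form U\<^sub>2 \<mu>\<^sub>2 = spectral_form U ev"
    using hermitian_spectral_theorem[OF hermitian_combination[OF hermitian_spectral_form hermitian_spectral_form]]
    by metis
  have "ev j = qform (spectral_form U ev) (column j U)" for j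
    by (simp add: qform_spectral_form_column U)
  then have "ev j = a * qform (spectral_form U\<^sub>1 \<mu>\<^sub>1) (column j U) + b * qform (spectral_form U\<^sub>2 \<mu>\<^sub>2) (column j U)" for j
    by (metis U(2) qform_linear)
  with U show thesis by (rule that)
qed

lemma convex_herm_mats:
  assumes S: "convex S"
  shows "convex (herm_mats S :: (complex^'n^'n) set)"
proof (rule convexI)
  fix A B :: "complex^'n^'n" and a b :: real
  assume "A \<in> herm_mats S" "B \<in> herm_mats S" and ab: "a \<ge> 0" "b \<ge> 0" "a + b = 1"
  then obtain U\<^sub>1 \<mu>\<^sub>1 U\<^sub>2 \<mu>\<^sub>2 where U: "unitary U\<^sub>1" "unitary U\<^sub>2" "range \<mu>\<^sub>1 \<subseteq> S" "range \<mu>\<^sub>2 \<subseteq> S"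
    and AB: "A = spectral_form U\<^sub>1 \<mu>\<^sub>1" "B = spectral_form U\<^sub>2 \<mu>\<^sub>2"
    by (metis herm_matsE)
  obtain U ev where V: "unitary U" "a *\<^sub>R A + b *\<^sub>R B = spectral_form U ev"
    and ev: "\<And>j. ev j = a * qform A (column j U) + b * qform B (column j U)"
    using spectral_form_combination[of a U\<^sub>1 \<mu>\<^sub>1 b U\<^sub>2 \<mu>\<^sub>2] AB by metis
  have "ev j \<in> S" for j
    using convexD[OF S _ _ ab] qform_column_mem[OF V(1) _ S] U by (simp add: ev AB)
  then show "a *\<^sub>R A + b *\<^sub>R B \<in> herm_mats S"
    unfolding V(2) by (intro spectral_form_in_herm_mats V) auto
qed

section \<open>The trace function\<close>

definition spectral_sum :: "(real^'m \<Rightarrow> real) \<Rightarrow> ('n::finite \<Rightarrow> real) \<Rightarrow> real" where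
  "spectral_sum f ev = (\<Sum>J\<in>(UNIV :: ('n^'m) set). f (\<chi> k. ev (J $ k)))"

text \<open>
  The same \<open>U\<close> diagonalizes every argument, and by cyclicity of the trace its Kronecker power
  cancels against its inverse.
\<close>

lemma trace_matrix_fun_spectral_form:
  fixes f :: "real^'m \<Rightarrow> real" and U :: "complex^'n^'n"
  assumes U: "unitary U"
  shows "trace (matrix_fun f (\<lambda>_. spectral_form U ev)) = complex_of_real (spectral_sum f ev)"
proof -
  let ?D = "diag_matrix (\<lambda>J :: 'n^'m. complex_of_real (f (\<chi> k. ev (J $ k))))"
  have "matrix_fun f (\<lambda>_. spectral_form U ev) = kron_spectral_form f (\<lambda>_. U) (\<lambda>_. ev)"
    by (intro matrix_fun_eq diagonalizes_spectral_form U)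
  also have "trace \<dots> = trace (?D ** (kron (\<lambda>_::'m. matrix_inv U) ** kron (\<lambda>_. U)))"
    unfolding kron_spectral_form_def
    by (metis matrix_mul_assoc trace_mul_sym)
  also have "kron (\<lambda>_::'m. matrix_inv U) ** kron (\<lambda>_. U) = mat 1"
    using U by (simp add: kron_mult unitary_matrix_inv unitary_def kron_mat_1)
  also have "trace (?D ** mat 1) = complex_of_real (spectral_sum f ev)"
    by (simp add: trace_def diag_matrix_def spectral_sum_def)
  finally show ?thesis .
qed

lemma trace_fun_spectral_form:
  "unitary U \<Longrightarrow> trace_fun f (spectral_form U ev) = spectral_sum f ev"
  by (simp add: trace_fun_def trace_matrix_fun_spectral_form)

lemma spectral_sum_permute:
  fixes f :: "real^'m \<Rightarrow> real" and \<sigma> :: "'n::finite \<Rightarrow> 'n"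
  assumes "bij \<sigma>"
  shows "spectral_sum f (ev \<circ> \<sigma>) = spectral_sum f ev"
  unfolding spectral_sum_def
  by (rule sum.reindex_bij_witness[where i = "\<lambda>J. \<chi> k. inv \<sigma> (J $ k)" and j = "\<lambda>J. \<chi> k. \<sigma> (J $ k)"])
    (use assms in \<open>auto simp: bij_is_inj bij_is_surj surj_f_inv_f\<close>)

lemma spectral_sum_uminus: "spectral_sum (\<lambda>x. - f x) ev = - spectral_sum f ev"
  by (simp add: spectral_sum_def sum_negf)

lemma trace_fun_uminus:
  assumes "L \<in> herm_mats S"
  shows "trace_fun (\<lambda>x. - f x) L = - trace_fun f L"
  using assms by (elim herm_matsE) (simp add: trace_fun_spectral_form spectral_sum_uminus)

section \<open>Monotonicity\<close>

text \<open>
  If for every threshold \<open>a\<close> has at least as many values above it as \<open>b\<close>, then the values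
  can be matched with \<open>b\<close> below \<open>a\<close>: pair a maximal value of \<open>a\<close> with a maximal value of \<open>b\<close>
  and remove both, which keeps the hypothesis on the counts.
\<close>

lemma dominating_bij:
  fixes a :: "'a \<Rightarrow> 'c::linorder" and b :: "'b \<Rightarrow> 'c"
  assumes "finite A" "finite B" "card A = card B"
    and "\<And>t. card {j\<in>B. t \<le> b j} \<le> card {i\<in>A. t \<le> a i}"
  shows "\<exists>\<sigma>. bij_betw \<sigma> A B \<and> (\<forall>i\<in>A. b (\<sigma> i) \<le> a i)"
  using assms
proof (induction "card A" arbitrary: A B)
  case 0
  then show ?case by (auto simp: bij_betw_def)
next
  case (Suc n)
  have ne: "A \<noteq> {}" "B \<noteq> {}" using Suc.hyps Suc.prems by auto
  obtain i where i: "i \<in> A" "\<And>x. x \<in> A \<Longrightarrow> a x \<le> a i"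
    using ne(1) Suc.prems(1) Max_in[of "a ` A"] Max_ge[of "a ` A"]
    by (metis (no_types, lifting) finite_imageI image_iff image_is_empty imageI)
  obtain j where j: "j \<in> B" "\<And>x. x \<in> B \<Longrightarrow> b x \<le> b j"
    using ne(2) Suc.prems(2) Max_in[of "b ` B"] Max_ge[of "b ` B"]
    by (metis (no_types, lifting) finite_imageI image_iff image_is_empty imageI)
  have "0 < card {x\<in>B. b j \<le> b x}" using j Suc.prems(2) by (auto simp: card_gt_0_iff)
  also have "\<dots> \<le> card {x\<in>A. b j \<le> a x}" by (rule Suc.prems)
  finally obtain x where "x \<in> A" "b j \<le> a x" by (auto simp: card_gt_0_iff)
  then have ij: "b j \<le> a i" using i by force
  have "card {x\<in>B - {j}. t \<le> b x} \<le> card {x\<in>A - {i}. t \<le> a x}" for t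
  proof (cases "t \<le> b j")
    case True
    then have "{x\<in>B - {j}. t \<le> b x} = {x\<in>B. t \<le> b x} - {j}" "{x\<in>A - {i}. t \<le> a x} = {x\<in>A. t \<le> a x} - {i}"
      and "j \<in> {x\<in>B. t \<le> b x}" "i \<in> {x\<in>A. t \<le> a x}"
      using i j ij by auto
    then show ?thesis using Suc.prems(4)[of t] by simp
  next
    case False
    then have "{x\<in>B - {j}. t \<le> b x} = {}" using j by force
    then show ?thesis by (simp only: card.empty)
  qed
  then obtain \<sigma> where \<sigma>: "bij_betw \<sigma> (A - {i}) (B - {j})" "\<And>x. x \<in> A - {i} \<Longrightarrow> b (\<sigma> x) \<le> a x"
    using Suc.hyps(1)[of "A - {i}" "B - {j}"] Suc.hyps(2) Suc.prems i j by force
  have "bij_betw (\<sigma>(i := j)) (insert i (A - {i})) (insert j (B - {j}))"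
    using \<sigma>(1) by (auto simp: bij_betw_def inj_on_def)
  then have "bij_betw (\<sigma>(i := j)) A B" using i j by (simp add: insert_absorb)
  moreover have "\<forall>x\<in>A. b ((\<sigma>(i := j)) x) \<le> a x" using \<sigma>(2) ij by auto
  ultimately show ?case by blast
qed

text \<open>
  Weyl's monotonicity principle. If the count failed, the span of the eigenvectors of the second
  matrix with eigenvalue \<open>\<ge> t\<close> and the span of those of the first with eigenvalue \<open>< t\<close> would
  have dimensions adding up to more than \<open>n\<close>, and a common nonzero vector \<open>x\<close> would have
  quadratic form at least \<open>t (x \<bullet> x)\<close> for the second matrix but less than \<open>t (x \<bullet> x)\<close> for
  the first.
\<close>

lemma loewner_ge_imp_count_le:
  fixes U V :: "complex^'n^'n"
  assumes U: "unitary U" and V: "unitary V" and ge: "spectral_form U ev \<succcurlyeq> spectral_form V \<mu>"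
  shows "card {j. t \<le> \<mu> j} \<le> card {i. t \<le> ev i}"
proof (rule ccontr)
  assume less: "\<not> ?thesis"
  \<comment> \<open>A vector lies in both spans iff it is orthogonal to the complementary eigenvectors.\<close>
  define B where "B = (\<lambda>i. column i U) ` {i. t \<le> ev i} \<union> (\<lambda>j. column j V) ` {j. \<not> t \<le> \<mu> j}"
  have "card {j. t \<le> \<mu> j} + card {j. \<not> t \<le> \<mu> j} = CARD('n)"
    by (subst card_Un_disjoint[symmetric]) (auto intro: arg_cong[of _ _ card])
  moreover have "card B \<le> card {i. t \<le> ev i} + card {j. \<not> t \<le> \<mu> j}"
    unfolding B_def by (intro order_trans[OF card_Un_le] add_mono card_image_le) auto
  ultimately have "card B < CARD('n)" using less by linarith
  moreover have "finite B" by (simp add: B_def)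
  ultimately obtain x where x: "x \<noteq> 0" "\<And>b. b \<in> B \<Longrightarrow> hprod b x = 0"
    by (metis exists_orthogonal_vector)
  have coord: "(conj_transpose W *v x) $ i = hprod (column i W) x" for W :: "complex^'n^'n" and i
    by (simp add: matrix_vector_mult_def conj_transpose_def hprod_def column_def)
  let ?p = "\<lambda>W i. (cmod ((conj_transpose W *v x) $ i))\<^sup>2"
  have pU: "?p U i = 0" if "t \<le> ev i" for i
    using that by (simp add: coord) (intro x, auto simp: B_def)
  have pV: "?p V j = 0" if "\<not> t \<le> \<mu> j" for j
    using that by (simp add: coord) (intro x, auto simp: B_def)
  have "(\<Sum>i\<in>UNIV. t * ?p U i) = (\<Sum>j\<in>UNIV. t * ?p V j)"
    by (simp add: unitary_isometry U V flip: sum_distrib_left)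
  also have "\<dots> \<le> qform (spectral_form V \<mu>) x"
    unfolding qform_spectral_form
  proof (rule sum_mono)
    show "t * ?p V j \<le> \<mu> j * ?p V j" for j
      using pV[of j] by (cases "t \<le> \<mu> j") (auto intro: mult_right_mono)
  qed
  also have "\<dots> \<le> qform (spectral_form U ev) x" by (rule loewner_ge_imp_qform[OF ge])
  finally have le: "(\<Sum>i\<in>UNIV. t * ?p U i) \<le> (\<Sum>i\<in>UNIV. ev i * ?p U i)"
    unfolding qform_spectral_form .
  have "0 < x \<bullet> x" using x(1) by simp
  then have "0 < (\<Sum>i\<in>UNIV. ?p U i)" by (simp only: unitary_isometry[OF U])
  then obtain k where k: "?p U k \<noteq> 0" by (metis (no_types, lifting) less_irrefl sum.neutral)
  have "(\<Sum>i\<in>UNIV. ev i * ?p U i) < (\<Sum>i\<in>UNIV. t * ?p U i)"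
  proof (rule sum_strict_mono_ex1)
    show "\<forall>i\<in>UNIV. ev i * ?p U i \<le> t * ?p U i"
    proof
      fix i
      show "ev i * ?p U i \<le> t * ?p U i"
        using pU[of i] by (cases "t \<le> ev i") (auto intro: mult_right_mono)
    qed
    have "ev k < t" using pU[of k] k by fastforce
    then show "\<exists>i\<in>UNIV. ev i * ?p U i < t * ?p U i"
      using k by (intro bexI[of _ k] mult_strict_right_mono) auto
  qed simp
  then show False using le by simp
qed

text \<open>
  Replace the coordinates of \<open>x\<close> by those of \<open>y\<close> one at a time; the intermediate points stay
  in the cube.
\<close>

lemma incr_in_each_mono:
  fixes f :: "real^'m \<Rightarrow> real"
  assumes f: "incr_in_each S f" and xy: "x \<in> cube S" "y \<in> cube S" "\<And>k. x $ k \<le> y $ k"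
  shows "f x \<le> f y"
proof -
  define z where "z K = (\<chi> k. if k \<in> K then y $ k else x $ k)" for K
  have "f x \<le> f (z K)" if "finite K" for K
    using that
  proof induction
    case empty
    show ?case by (simp add: z_def)
  next
    case (insert k K)
    have z: "z K \<in> cube S" using xy by (simp add: z_def cube_def)
    have upd: "(\<chi> l. if l = k then x $ k else z K $ l) = z K"
      "(\<chi> l. if l = k then y $ k else z K $ l) = z (insert k K)"
      using insert.hyps by (auto simp: z_def vec_eq_iff)
    have "mono_on S (\<lambda>t. f (\<chi> l. if l = k then t else z K $ l))"
      using f z by (simp add: incr_in_each_def)
    from mono_onD[OF this, of "x $ k" "y $ k"] have "f (z K) \<le> f (z (insert k K))"
      using xy by (simp add: upd cube_def)
    with insert.IH show ?case by simp
  qed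
  from this[of UNIV] show ?thesis by (simp add: z_def)
qed

theorem trace_fun_mono:
  fixes f :: "real^'m \<Rightarrow> real" and L\<^sub>1 L\<^sub>2 :: "complex^'n^'n"
  assumes f: "incr_in_each S f" and L: "L\<^sub>1 \<in> herm_mats S" "L\<^sub>2 \<in> herm_mats S" "L\<^sub>1 \<succcurlyeq> L\<^sub>2"
  shows "trace_fun f L\<^sub>2 \<le> trace_fun f L\<^sub>1"
proof -
  obtain U ev V \<mu> where U: "unitary U" "range ev \<subseteq> S" "L\<^sub>1 = spectral_form U ev"
    and V: "unitary V" "range \<mu> \<subseteq> S" "L\<^sub>2 = spectral_form V \<mu>"
    using L by (metis herm_matsE)
  have "\<exists>\<sigma>. bij \<sigma> \<and> (\<forall>i\<in>UNIV. \<mu> (\<sigma> i) \<le> ev i)"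
    using loewner_ge_imp_count_le[OF U(1) V(1)] L(3) by (intro dominating_bij) (auto simp: U V)
  then obtain \<sigma> where \<sigma>: "bij \<sigma>" "\<And>i. \<mu> (\<sigma> i) \<le> ev i" by blast
  have "spectral_sum f \<mu> = spectral_sum f (\<mu> \<circ> \<sigma>)" by (simp add: spectral_sum_permute \<sigma>)
  also have "\<dots> \<le> spectral_sum f ev"
    unfolding spectral_sum_def
    by (intro sum_mono incr_in_each_mono[OF f]) (use U V \<sigma> in \<open>auto simp: cube_def\<close>)
  finally show ?thesis using U V by (simp add: trace_fun_spectral_form)
qed

section \<open>Convexity\<close>

text \<open>Distributivity, with the choice functions written as vectors.\<close>

lemma sum_prod_vec:
  fixes g :: "'m::finite \<Rightarrow> 'n::finite \<Rightarrow> 'a::comm_semiring_1"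
  shows "(\<Sum>K\<in>(UNIV :: ('n^'m) set). \<Prod>k\<in>UNIV. g k (K $ k)) = (\<Prod>k\<in>UNIV. \<Sum>l\<in>UNIV. g k l)"
proof -
  have "(\<Prod>k\<in>UNIV. \<Sum>l\<in>UNIV. g k l) = (\<Sum>h\<in>UNIV. \<Prod>k\<in>UNIV. g k (h k))"
    using prod_sum_PiE[of "UNIV :: 'm set" "\<lambda>_. UNIV :: 'n set" g] by simp
  also have "\<dots> = (\<Sum>K\<in>(UNIV :: ('n^'m) set). \<Prod>k\<in>UNIV. g k (K $ k))"
    by (rule sum.reindex_bij_witness[where i = vec_nth and j = vec_lambda]) auto
  finally show ?thesis by simp
qed

text \<open>
  The mean of a product distribution is computed coordinatewise: in the \<open>i\<close>-th coordinate all
  factors but the \<open>i\<close>-th sum to one.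
\<close>

lemma product_weights_barycentre:
  fixes w :: "'m::finite \<Rightarrow> 'n::finite \<Rightarrow> real"
  assumes "\<And>k. (\<Sum>l\<in>UNIV. w k l) = 1"
  shows "(\<Sum>K\<in>(UNIV :: ('n^'m) set). (\<Prod>k\<in>UNIV. w k (K $ k)) *\<^sub>R (\<chi> k. \<mu> (K $ k)))
    = (\<chi> k. \<Sum>l\<in>UNIV. w k l * \<mu> l)"
proof -
  have "(\<Sum>K\<in>(UNIV :: ('n^'m) set). (\<Prod>k\<in>UNIV. w k (K $ k)) * \<mu> (K $ i)) = (\<Sum>l\<in>UNIV. w i l * \<mu> l)" for i
  proof -
    define g where "g k l = w k l * (if k = i then \<mu> l else 1)" for k l
    have "(\<Prod>k\<in>UNIV. w k (K $ k)) * \<mu> (K $ i) = (\<Prod>k\<in>UNIV. g k (K $ k))" for K :: "'n^'m"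
      by (simp add: g_def prod.distrib)
    then have "(\<Sum>K\<in>(UNIV :: ('n^'m) set). (\<Prod>k\<in>UNIV. w k (K $ k)) * \<mu> (K $ i)) = (\<Prod>k\<in>UNIV. \<Sum>l\<in>UNIV. g k l)"
      by (simp add: sum_prod_vec)
    also have "\<dots> = (\<Prod>k\<in>UNIV. if k = i then \<Sum>l\<in>UNIV. w i l * \<mu> l else 1)"
      by (rule prod.cong) (auto simp: g_def assms)
    finally show ?thesis by simp
  qed
  then show ?thesis by (simp add: vec_eq_iff)
qed

text \<open>
  A version of the Peierls inequality in several variables: replacing the eigenvalues by the values of the
  quadratic form at another orthonormal basis does not increase the sum. Each tuple of such values is
  the mean of the tuples of eigenvalues for a row of the Kronecker power of the overlap matrix. Jensen's
  inequality bounds \<open>f\<close> there, and since the columns of that power also sum to one, summing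
  over the rows counts every tuple of eigenvalues exactly once.
\<close>

lemma peierls_inequality:
  fixes f :: "real^'m \<Rightarrow> real" and U V :: "complex^'n^'n"
  assumes f: "convex_on (cube S) f" and U: "unitary U" and V: "unitary V" and \<mu>: "range \<mu> \<subseteq> S"
  shows "spectral_sum f (\<lambda>j. qform (spectral_form V \<mu>) (column j U)) \<le> spectral_sum f \<mu>"
proof -
  define w where "w J K = (\<Prod>k\<in>UNIV. overlap U V (J $ k) (K $ k))" for J K :: "'n^'m"
  have w_nonneg: "w J K \<ge> 0" for J K by (simp add: w_def prod_nonneg overlap_nonneg)
  have sum_w: "(\<Sum>K\<in>UNIV. w J K) = 1" "(\<Sum>J\<in>UNIV. w J K) = 1" for J K
    unfolding w_def
    by (simp_all add: sum_prod_vec[where g = "\<lambda>k l. overlap U V (J $ k) l"]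
        sum_prod_vec[where g = "\<lambda>k l. overlap U V l (K $ k)"] sum_overlap sum_overlap' U V)
  have "f (\<chi> k. qform (spectral_form V \<mu>) (column (J $ k) U)) \<le> (\<Sum>K\<in>UNIV. w J K * f (\<chi> k. \<mu> (K $ k)))" for J
  proof -
    have "(\<chi> k. qform (spectral_form V \<mu>) (column (J $ k) U)) = (\<Sum>K\<in>UNIV. w J K *\<^sub>R (\<chi> k. \<mu> (K $ k)))"
      unfolding w_def qform_eq_overlap
      by (rule product_weights_barycentre[symmetric]) (simp add: sum_overlap U V)
    also have "f \<dots> \<le> (\<Sum>K\<in>UNIV. w J K * f (\<chi> k. \<mu> (K $ k)))"
      by (rule convex_on_sum[OF _ _ f]) (use \<mu> in \<open>auto simp: sum_w w_nonneg cube_def\<close>)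
    finally show ?thesis .
  qed
  then have "spectral_sum f (\<lambda>j. qform (spectral_form V \<mu>) (column j U))
      \<le> (\<Sum>J\<in>UNIV. \<Sum>K\<in>UNIV. w J K * f (\<chi> k. \<mu> (K $ k)))"
    unfolding spectral_sum_def by (intro sum_mono)
  also have "\<dots> = (\<Sum>K\<in>UNIV. (\<Sum>J\<in>UNIV. w J K) * f (\<chi> k. \<mu> (K $ k)))"
    by (subst sum.swap) (simp add: sum_distrib_right)
  also have "\<dots> = spectral_sum f \<mu>" by (simp add: sum_w spectral_sum_def)
  finally show ?thesis .
qed

theorem trace_fun_convex:
  fixes f :: "real^'m \<Rightarrow> real"
  assumes S: "convex S" and f: "convex_on (cube S) f"
  shows "convex_on (herm_mats S :: (complex^'n^'n) set) (trace_fun f)"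
  unfolding convex_on_def
proof (intro conjI ballI allI impI)
  show "convex (herm_mats S :: (complex^'n^'n) set)" by (rule convex_herm_mats[OF S])
next
  fix A B :: "complex^'n^'n" and a b :: real
  assume "A \<in> herm_mats S" "B \<in> herm_mats S" and ab: "a \<ge> 0" "b \<ge> 0" "a + b = 1"
  then obtain U\<^sub>1 \<mu>\<^sub>1 U\<^sub>2 \<mu>\<^sub>2 where U: "unitary U\<^sub>1" "unitary U\<^sub>2" "range \<mu>\<^sub>1 \<subseteq> S" "range \<mu>\<^sub>2 \<subseteq> S"
    and AB: "A = spectral_form U\<^sub>1 \<mu>\<^sub>1" "B = spectral_form U\<^sub>2 \<mu>\<^sub>2"
    by (metis herm_matsE)
  obtain U ev where V: "unitary U" "a *\<^sub>R A + b *\<^sub>R B = spectral_form U ev"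
    and ev: "\<And>j. ev j = a * qform A (column j U) + b * qform B (column j U)"
    using spectral_form_combination[of a U\<^sub>1 \<mu>\<^sub>1 b U\<^sub>2 \<mu>\<^sub>2] AB by metis
  let ?x = "\<lambda>J :: 'n^'m. \<chi> k. qform A (column (J $ k) U)" and ?y = "\<lambda>J :: 'n^'m. \<chi> k. qform B (column (J $ k) U)"
  have xy: "?x J \<in> cube S" "?y J \<in> cube S" for J
    using qform_column_mem[OF V(1) _ S] U by (auto simp: cube_def AB)
  have "spectral_sum f ev = (\<Sum>J\<in>UNIV. f (a *\<^sub>R ?x J + b *\<^sub>R ?y J))"
    unfolding spectral_sum_def
    by (intro sum.cong arg_cong[of _ _ f]) (auto simp: vec_eq_iff ev)
  also have "\<dots> \<le> (\<Sum>J\<in>UNIV. a * f (?x J) + b * f (?y J))"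
    using f xy ab by (intro sum_mono) (simp add: convex_on_def)
  also have "\<dots> = a * spectral_sum f (\<lambda>j. qform A (column j U)) + b * spectral_sum f (\<lambda>j. qform B (column j U))"
    by (simp add: spectral_sum_def sum.distrib sum_distrib_left)
  also have "\<dots> \<le> a * spectral_sum f \<mu>\<^sub>1 + b * spectral_sum f \<mu>\<^sub>2"
    unfolding AB by (intro add_mono mult_left_mono peierls_inequality[OF f] U V ab)
  finally show "trace_fun f (a *\<^sub>R A + b *\<^sub>R B) \<le> a * trace_fun f A + b * trace_fun f B"
    unfolding V(2) by (simp add: AB trace_fun_spectral_form U V)
qed


corollary trace_fun_concave:
  fixes f :: "real^'m \<Rightarrow> real"
  assumes S: "convex S" and f: "concave_on (cube S) f"
  shows "concave_on (herm_mats S :: (complex^'n^'n) set) (trace_fun f)"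
proof -
  have neg: "convex_on (herm_mats S :: (complex^'n^'n) set) (trace_fun (\<lambda>x. - f x))"
    using f unfolding concave_on_def by (rule trace_fun_convex[OF S])
  have "trace_fun (\<lambda>x. - f x) (a *\<^sub>R A + b *\<^sub>R B) = - trace_fun f (a *\<^sub>R A + b *\<^sub>R B)"
    if "A \<in> herm_mats S" "B \<in> herm_mats S" "a \<ge> 0" "b \<ge> 0" "a + b = 1"
    for A B :: "complex^'n^'n" and a b :: real
    by (rule trace_fun_uminus[OF convexD[OF convex_herm_mats[OF S] that]])
  then show ?thesis
    using neg by (auto simp: concave_on_def convex_on_def trace_fun_uminus)
qed

theorem proposition2p6:
  fixes S :: "real set" and f :: "real^'m \<Rightarrow> real"
  assumes "is_interval S"
  shows
    "(\<forall>L \<in> (herm_mats S :: (complex^'n^'n) set). \<forall>ev. lists_eigenvalues L ev \<longrightarrow>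
        trace (matrix_fun f (\<lambda>_. L)) = complex_of_real (trace_fun f L) \<and>
        trace_fun f L = (\<Sum>J\<in>(UNIV :: ('n^'m) set). f (\<chi> k. ev (J $ k))))
   \<and> (Ck_on CARD('m) f (cube S) \<and> incr_in_each S f \<longrightarrow>
        (\<forall>L\<^sub>1 \<in> (herm_mats S :: (complex^'n^'n) set). \<forall>L\<^sub>2 \<in> herm_mats S.
           L\<^sub>1 \<succcurlyeq> L\<^sub>2 \<longrightarrow> trace_fun f L\<^sub>1 \<ge> trace_fun f L\<^sub>2))
   \<and> (Ck_on CARD('m) f (cube S) \<and> decr_in_each S f \<longrightarrow>
        (\<forall>L\<^sub>1 \<in> (herm_mats S :: (complex^'n^'n) set). \<forall>L\<^sub>2 \<in> herm_mats S.
           L\<^sub>1 \<succcurlyeq> L\<^sub>2 \<longrightarrow> trace_fun f L\<^sub>1 \<le> trace_fun f L\<^sub>2))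
   \<and> (Ck_on 0 f (cube S) \<and> convex_on (cube S) f \<longrightarrow>
        convex_on (herm_mats S :: (complex^'n^'n) set) (trace_fun f))
   \<and> (Ck_on 0 f (cube S) \<and> concave_on (cube S) f \<longrightarrow>
        concave_on (herm_mats S :: (complex^'n^'n) set) (trace_fun f))"
proof (intro conjI ballI allI impI)
  fix L :: "complex^'n^'n" and ev
  assume L: "L \<in> herm_mats S" and ev: "lists_eigenvalues L ev"
  obtain U \<mu> where U: "unitary U" "L = spectral_form U \<mu>" using L by (rule herm_matsE)
  obtain \<sigma> where \<sigma>: "bij \<sigma>" "ev = \<mu> \<circ> \<sigma>"
    using lists_eigenvalues_unique[OF ev] lists_eigenvalues_spectral_form[OF U(1)] U(2) by metis
  show "trace (matrix_fun f (\<lambda>_. L)) = complex_of_real (trace_fun f L)"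
    using U by (simp add: trace_fun_spectral_form trace_matrix_fun_spectral_form)
  have "trace_fun f L = spectral_sum f ev"
    using U by (simp add: trace_fun_spectral_form \<sigma> spectral_sum_permute)
  then show "trace_fun f L = (\<Sum>J\<in>(UNIV :: ('n^'m) set). f (\<chi> k. ev (J $ k)))"
    by (simp add: spectral_sum_def)
next
  fix L\<^sub>1 L\<^sub>2 :: "complex^'n^'n"
  assume L: "L\<^sub>1 \<in> herm_mats S" "L\<^sub>2 \<in> herm_mats S" "L\<^sub>1 \<succcurlyeq> L\<^sub>2"
  {
    assume "Ck_on CARD('m) f (cube S) \<and> incr_in_each S f"
    then show "trace_fun f L\<^sub>1 \<ge> trace_fun f L\<^sub>2" using L by (blast intro: trace_fun_mono)
  next
    assume "Ck_on CARD('m) f (cube S) \<and> decr_in_each S f"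
    then have "incr_in_each S (\<lambda>x. - f x)"
      by (simp add: incr_in_each_def decr_in_each_def monotone_on_def)
    from trace_fun_mono[OF this L] show "trace_fun f L\<^sub>1 \<le> trace_fun f L\<^sub>2"
      using L by (simp add: trace_fun_uminus)
  }
next
  assume "Ck_on 0 f (cube S) \<and> convex_on (cube S) f"
  then show "convex_on (herm_mats S :: (complex^'n^'n) set) (trace_fun f)"
    using assms by (simp add: trace_fun_convex is_interval_convex_1)
next
  assume "Ck_on 0 f (cube S) \<and> concave_on (cube S) f"
  then show "concave_on (herm_mats S :: (complex^'n^'n) set) (trace_fun f)"
    using assms by (simp add: trace_fun_concave is_interval_convex_1)
qed

end
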